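(* Let $G$ be a reductive group and let $V_1,V_2$ be finite dimensional $G$-modules such that $(G,V_1\oplus V_2)$ is saturated. Then $(G,V_1\oplus V_2)$ is skew multiplicity-free if and only if $(G,V_1\oplus V_2^* )$ is skew multiplicity-free, where $V_2^*$ is the dual $G$-module of $V_2$.
   Context: All groups are complex algebraic groups and representations are finite dimensional over $\mathbb{C}$. $(G,V)$ is skew multiplicity-free (SMF) if $\bigwedge V$ is a multiplicity-free $G$-module. A representation of $G$ on $V=U_1\oplus\dots\oplus U_l$ ($U_j$ irreducible) is saturated if $G=(\mathbb{C}^* )^l\times G_1\times\dots\times G_k=(\mathbb{C}^* )^l\times[G,G]$ with $G_i$ simple groups, where the $j$-th torus factor acts by scalar multiplication on $U_j$ and trivially on all other $U_i$. *)

theory Defs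
  imports
    Complex_Main
    "HOL-Library.Poly_Mapping"
    "HOL-Library.Product_Plus"
    "HOL-Library.FuncSet"
    "HOL-Algebra.Generated_Groups"
    "Jordan_Normal_Form.Matrix"
    "Jordan_Normal_Form.Determinant"
begin

section \<open>Complex vector spaces\<close>

class complex_vector = ab_group_add +
  fixes scaleC :: "complex \<Rightarrow> 'a \<Rightarrow> 'a"  (infixr \<open>*\<^sub>C\<close> 75)
  assumes scaleC_add_right: "a *\<^sub>C (x + y) = a *\<^sub>C x + a *\<^sub>C y"
    and scaleC_add_left: "(a + b) *\<^sub>C x = a *\<^sub>C x + b *\<^sub>C x"
    and scaleC_scaleC: "a *\<^sub>C b *\<^sub>C x = (a * b) *\<^sub>C x"
    and scaleC_one: "1 *\<^sub>C x = x"

global_interpretation cvec: vector_space "scaleC :: complex \<Rightarrow> 'a \<Rightarrow> 'a::complex_vector"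
  by unfold_locales
    (simp_all add: scaleC_add_right scaleC_add_left scaleC_scaleC scaleC_one)

abbreviation clinear :: "('a::complex_vector \<Rightarrow> 'b::complex_vector) \<Rightarrow> bool"
  where "clinear \<equiv> Vector_Spaces.linear scaleC scaleC"

lemma clinear_iff:
  "clinear f \<longleftrightarrow> (\<forall>x y. f (x + y) = f x + f y) \<and> (\<forall>c x. f (c *\<^sub>C x) = c *\<^sub>C f x)"
  by (simp add: Vector_Spaces.linear_iff cvec.vector_space_axioms)

definition finite_dim :: "'v::complex_vector itself \<Rightarrow> bool"
  where "finite_dim _ \<longleftrightarrow> (\<exists>B::'v set. finite B \<and> cvec.span B = UNIV)"

instantiation complex :: complex_vector
begin

definition scaleC_complex_def: "c *\<^sub>C (x::complex) = c * x"

instance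
  by standard (simp_all add: scaleC_complex_def algebra_simps)

end

instantiation prod :: (complex_vector, complex_vector) complex_vector
begin

definition scaleC_prod_def: "c *\<^sub>C p = (c *\<^sub>C fst p, c *\<^sub>C snd p)"

instance
  by standard (simp_all add: scaleC_prod_def prod_eq_iff
      scaleC_add_right scaleC_add_left scaleC_scaleC scaleC_one)

end

instantiation poly_mapping :: (type, complex_vector) complex_vector
begin

lift_definition scaleC_poly_mapping :: "complex \<Rightarrow> ('a \<Rightarrow>\<^sub>0 'b) \<Rightarrow> ('a \<Rightarrow>\<^sub>0 'b)"
  is "\<lambda>c f k. c *\<^sub>C f k"
proof -
  fix c and f :: "'a \<Rightarrow> 'b"
  assume "finite {k. f k \<noteq> 0}"
  moreover have "{k. c *\<^sub>C f k \<noteq> 0} \<subseteq> {k. f k \<noteq> 0}" by auto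
  ultimately show "finite {k. c *\<^sub>C f k \<noteq> 0}" by (rule rev_finite_subset)
qed

instance
  by (standard; transfer; simp add: fun_eq_iff
      scaleC_add_right scaleC_add_left scaleC_scaleC scaleC_one)

end


section \<open>Dual space\<close>

typedef (overloaded) 'v dual = "{f :: 'v::complex_vector \<Rightarrow> complex. clinear f}"
  morphisms dual_apply Dual
  by (rule exI[of _ "\<lambda>_. 0"]) (simp add: clinear_iff)

setup_lifting type_definition_dual

instantiation dual :: (complex_vector) complex_vector
begin

lift_definition zero_dual :: "'a dual" is "\<lambda>_. 0"
  by (simp add: clinear_iff)

lift_definition plus_dual :: "'a dual \<Rightarrow> 'a dual \<Rightarrow> 'a dual" is "\<lambda>f g x. f x + g x"
  by (simp add: clinear_iff scaleC_complex_def algebra_simps)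

lift_definition minus_dual :: "'a dual \<Rightarrow> 'a dual \<Rightarrow> 'a dual" is "\<lambda>f g x. f x - g x"
  by (simp add: clinear_iff scaleC_complex_def algebra_simps)

lift_definition uminus_dual :: "'a dual \<Rightarrow> 'a dual" is "\<lambda>f x. - f x"
  by (simp add: clinear_iff scaleC_complex_def algebra_simps)

lift_definition scaleC_dual :: "complex \<Rightarrow> 'a dual \<Rightarrow> 'a dual" is "\<lambda>c f x. c * f x"
  by (simp add: clinear_iff scaleC_complex_def algebra_simps)

instance
  by (standard; transfer; simp add: fun_eq_iff algebra_simps)

end


section \<open>Exterior algebra\<close>

text \<open>
  The exterior algebra of \<open>V\<close> is presented as the tensor algebra modulo the two-sided
  ideal generated by all \<open>v \<otimes> v\<close>.  The free vector space on all words \<open>v\<^sub>1 \<dots> v\<^sub>k\<close> over \<open>V\<close>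
  (of every length \<open>k \<ge> 0\<close>) is divided by the relations making words multilinear, which
  gives the tensor algebra, and by the words \<open>u v v w\<close>, which span that ideal.
\<close>

inductive_set ext_relations :: "('v::complex_vector list \<Rightarrow>\<^sub>0 complex) set" where
  add: "Poly_Mapping.single (u @ [v + v'] @ w) 1
    - Poly_Mapping.single (u @ [v] @ w) 1 - Poly_Mapping.single (u @ [v'] @ w) 1 \<in> ext_relations"
| scale: "Poly_Mapping.single (u @ [c *\<^sub>C v] @ w) 1
    - c *\<^sub>C Poly_Mapping.single (u @ [v] @ w) 1 \<in> ext_relations"
| square: "Poly_Mapping.single (u @ [v, v] @ w) 1 \<in> ext_relations"

definition ext_eq :: "('v::complex_vector list \<Rightarrow>\<^sub>0 complex) \<Rightarrow> ('v list \<Rightarrow>\<^sub>0 complex) \<Rightarrow> bool"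
  where "ext_eq x y \<longleftrightarrow> x - y \<in> cvec.span ext_relations"

lemma equivp_reflp_eq: "equivp R \<Longrightarrow> x = y \<Longrightarrow> R x y"
  by (simp add: equivp_reflp)

lemma equivp_ext_eq: "equivp (ext_eq :: ('v::complex_vector list \<Rightarrow>\<^sub>0 complex) \<Rightarrow> _)"
proof (rule equivpI)
  show "reflp (ext_eq :: ('v list \<Rightarrow>\<^sub>0 complex) \<Rightarrow> _)"
    by (simp add: reflp_def ext_eq_def cvec.span_zero)
  show "symp (ext_eq :: ('v list \<Rightarrow>\<^sub>0 complex) \<Rightarrow> _)"
  proof (rule sympI)
    fix x y :: "'v list \<Rightarrow>\<^sub>0 complex"
    assume "ext_eq x y"
    from cvec.span_neg[OF this[unfolded ext_eq_def]] show "ext_eq y x"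
      by (simp add: ext_eq_def)
  qed
  show "transp (ext_eq :: ('v list \<Rightarrow>\<^sub>0 complex) \<Rightarrow> _)"
  proof (rule transpI)
    fix x y z :: "'v list \<Rightarrow>\<^sub>0 complex"
    assume "ext_eq x y" "ext_eq y z"
    from cvec.span_add[OF this[unfolded ext_eq_def]] show "ext_eq x z"
      by (simp add: ext_eq_def)
  qed
qed

quotient_type (overloaded) 'v ext = "'v::complex_vector list \<Rightarrow>\<^sub>0 complex" / ext_eq
  by (rule equivp_ext_eq)

instantiation ext :: (complex_vector) complex_vector
begin

lift_definition zero_ext :: "'a ext" is 0 .

lift_definition plus_ext :: "'a ext \<Rightarrow> 'a ext \<Rightarrow> 'a ext" is "(+)"
proof -
  fix a b c d :: "'a list \<Rightarrow>\<^sub>0 complex"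
  assume "ext_eq a b" "ext_eq c d"
  then have "(a - b) + (c - d) \<in> cvec.span ext_relations"
    unfolding ext_eq_def by (rule cvec.span_add)
  then show "ext_eq (a + c) (b + d)"
    by (simp only: ext_eq_def add_diff_add)
qed

lift_definition uminus_ext :: "'a ext \<Rightarrow> 'a ext" is uminus
proof -
  fix a b :: "'a list \<Rightarrow>\<^sub>0 complex"
  assume "ext_eq a b"
  then have "- (a - b) \<in> cvec.span ext_relations"
    unfolding ext_eq_def by (rule cvec.span_neg)
  then show "ext_eq (- a) (- b)"
    by (simp only: ext_eq_def minus_diff_minus)
qed

lift_definition minus_ext :: "'a ext \<Rightarrow> 'a ext \<Rightarrow> 'a ext" is "(-)"
proof -
  fix a b c d :: "'a list \<Rightarrow>\<^sub>0 complex"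
  assume "ext_eq a b" "ext_eq c d"
  then have "(a - b) - (c - d) \<in> cvec.span ext_relations"
    unfolding ext_eq_def by (rule cvec.span_diff)
  moreover have "(a - b) - (c - d) = (a - c) - (b - d)" by simp
  ultimately show "ext_eq (a - c) (b - d)"
    by (simp only: ext_eq_def)
qed

lift_definition scaleC_ext :: "complex \<Rightarrow> 'a ext \<Rightarrow> 'a ext" is "(*\<^sub>C)"
proof -
  fix c and a b :: "'a list \<Rightarrow>\<^sub>0 complex"
  assume "ext_eq a b"
  then have "c *\<^sub>C (a - b) \<in> cvec.span ext_relations"
    unfolding ext_eq_def by (rule cvec.span_scale)
  then show "ext_eq (c *\<^sub>C a) (c *\<^sub>C b)"
    by (simp only: ext_eq_def cvec.scale_right_diff_distrib)
qed

instance
  by (standard; transfer; rule equivp_reflp_eq[OF equivp_ext_eq];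
      simp add: add.assoc add.commute scaleC_add_right scaleC_add_left)

end

lift_definition wedge :: "'v::complex_vector list \<Rightarrow> 'v ext"
  is "\<lambda>vs. Poly_Mapping.single vs 1" .

lemma wedge_add: "wedge (u @ [v + v'] @ w) = wedge (u @ [v] @ w) + wedge (u @ [v'] @ w)"
  by transfer
    (use cvec.span_base[OF ext_relations.add] in \<open>simp add: ext_eq_def diff_diff_eq\<close>)

lemma wedge_scale: "wedge (u @ [c *\<^sub>C v] @ w) = c *\<^sub>C wedge (u @ [v] @ w)"
  by transfer (use cvec.span_base[OF ext_relations.scale] in \<open>simp add: ext_eq_def\<close>)

lemma wedge_square: "wedge (u @ [v, v] @ w) = 0"
  by transfer (use cvec.span_base[OF ext_relations.square] in \<open>simp add: ext_eq_def\<close>)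

text \<open>
  The induced map on exterior algebras: the linear map with
  \<open>v\<^sub>1 \<and> \<dots> \<and> v\<^sub>k \<mapsto> f v\<^sub>1 \<and> \<dots> \<and> f v\<^sub>k\<close>; it is well defined for linear \<open>f\<close> by
  \<open>ext_map_ex1\<close> below.
\<close>

definition ext_map :: "('v::complex_vector \<Rightarrow> 'w::complex_vector) \<Rightarrow> 'v ext \<Rightarrow> 'w ext"
  where "ext_map f = (THE h. clinear h \<and> (\<forall>vs. h (wedge vs) = wedge (map f vs)))"


section \<open>Linear algebraic groups over the complex numbers\<close>

definition GL :: "nat \<Rightarrow> complex mat monoid"
  where "GL n = \<lparr>carrier = {A \<in> carrier_mat n n. det A \<noteq> 0}, monoid.mult = (*), one = 1\<^sub>m n\<rparr>"

text \<open>The coordinate ring of \<open>GL n\<close>: polynomials in the matrix entries and \<open>1 / det\<close>.\<close>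

inductive_set coord_ring :: "nat \<Rightarrow> (complex mat \<Rightarrow> complex) set" for n :: nat where
  const: "(\<lambda>_. c) \<in> coord_ring n"
| entry: "i < n \<Longrightarrow> j < n \<Longrightarrow> (\<lambda>A. A $$ (i, j)) \<in> coord_ring n"
| inv_det: "(\<lambda>A. 1 / det A) \<in> coord_ring n"
| add: "p \<in> coord_ring n \<Longrightarrow> q \<in> coord_ring n \<Longrightarrow> (\<lambda>A. p A + q A) \<in> coord_ring n"
| mult: "p \<in> coord_ring n \<Longrightarrow> q \<in> coord_ring n \<Longrightarrow> (\<lambda>A. p A * q A) \<in> coord_ring n"

definition zariski_closed :: "nat \<Rightarrow> complex mat set \<Rightarrow> bool"
  where "zariski_closed n X \<longleftrightarrow>
    (\<exists>P \<subseteq> coord_ring n. X = {A \<in> carrier (GL n). \<forall>p\<in>P. p A = 0})"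

definition zariski_connected :: "nat \<Rightarrow> complex mat set \<Rightarrow> bool"
  where "zariski_connected n X \<longleftrightarrow>
    \<not> (\<exists>Y Z. zariski_closed n Y \<and> zariski_closed n Z \<and> Y \<noteq> {} \<and> Z \<noteq> {} \<and>
            Y \<inter> Z = {} \<and> Y \<union> Z = X)"

definition regular_on :: "nat \<Rightarrow> complex mat set \<Rightarrow> (complex mat \<Rightarrow> complex) \<Rightarrow> bool"
  where "regular_on n X f \<longleftrightarrow> (\<exists>p\<in>coord_ring n. \<forall>A\<in>X. f A = p A)"

definition alg_group :: "nat \<Rightarrow> complex mat set \<Rightarrow> bool"
  where "alg_group n G \<longleftrightarrow> subgroup G (GL n) \<and> zariski_closed n G"

abbreviation grp :: "nat \<Rightarrow> complex mat set \<Rightarrow> complex mat monoid"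
  where "grp n G \<equiv> (GL n)\<lparr>carrier := G\<rparr>"

definition unipotent :: "nat \<Rightarrow> complex mat \<Rightarrow> bool"
  where "unipotent n A \<longleftrightarrow> (\<exists>k. (A - 1\<^sub>m n) ^\<^sub>m k = 0\<^sub>m n n)"

text \<open>Reductive means that the unipotent radical is trivial; connectedness is not required.\<close>

definition reductive :: "nat \<Rightarrow> complex mat set \<Rightarrow> bool"
  where "reductive n G \<longleftrightarrow> alg_group n G \<and>
    (\<forall>U. U \<lhd> grp n G \<and> zariski_closed n U \<and> zariski_connected n U \<and> (\<forall>u\<in>U. unipotent n u)
       \<longrightarrow> U = {1\<^sub>m n})"

text \<open>Simple in the sense of algebraic groups: a finite centre is allowed.\<close>

definition simple_alg_group :: "nat \<Rightarrow> complex mat set \<Rightarrow> bool"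
  where "simple_alg_group n G \<longleftrightarrow> alg_group n G \<and> zariski_connected n G \<and>
    (\<exists>g\<in>G. \<exists>h\<in>G. g * h \<noteq> h * g) \<and>
    (\<forall>N. N \<lhd> grp n G \<and> zariski_closed n N \<and> zariski_connected n N \<longrightarrow> N = {1\<^sub>m n} \<or> N = G)"

definition alg_iso :: "nat \<Rightarrow> complex mat set \<Rightarrow> nat \<Rightarrow> complex mat set
    \<Rightarrow> (complex mat \<Rightarrow> complex mat) \<Rightarrow> bool"
  where "alg_iso n G m H \<phi> \<longleftrightarrow> \<phi> \<in> iso (grp n G) (grp m H) \<and>
    (\<forall>i<m. \<forall>j<m. regular_on n G (\<lambda>g. \<phi> g $$ (i, j))) \<and>
    (\<forall>i<n. \<forall>j<n. regular_on m H (\<lambda>h. inv_into G \<phi> h $$ (i, j)))"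

text \<open>The direct product of groups \<open>H\<^sub>i \<le> GL (n\<^sub>i)\<close>, realised by block diagonal matrices.\<close>

definition prod_size :: "(nat \<times> complex mat set) list \<Rightarrow> nat"
  where "prod_size Hs = sum_list (map fst Hs)"

definition prod_group :: "(nat \<times> complex mat set) list \<Rightarrow> complex mat set"
  where "prod_group Hs = {diag_block_mat hs |hs. list_all2 (\<lambda>h (m, H). h \<in> H) hs Hs}"


section \<open>Modules\<close>

definition rational_module ::
    "nat \<Rightarrow> complex mat set \<Rightarrow> (complex mat \<Rightarrow> 'v::complex_vector \<Rightarrow> 'v) \<Rightarrow> bool"
  where "rational_module n G \<rho> \<longleftrightarrow> finite_dim TYPE('v) \<and>
    (\<forall>g\<in>G. clinear (\<rho> g)) \<and>
    (\<forall>v. \<rho> (1\<^sub>m n) v = v) \<and>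
    (\<forall>g\<in>G. \<forall>h\<in>G. \<forall>v. \<rho> (g * h) v = \<rho> g (\<rho> h v)) \<and>
    (\<forall>v f. clinear f \<longrightarrow> regular_on n G (\<lambda>g. f (\<rho> g v)))"

definition direct_sum_act ::
    "('g \<Rightarrow> 'v \<Rightarrow> 'v) \<Rightarrow> ('g \<Rightarrow> 'w \<Rightarrow> 'w) \<Rightarrow> 'g \<Rightarrow> 'v \<times> 'w \<Rightarrow> 'v \<times> 'w"
  where "direct_sum_act \<rho> \<sigma> g = map_prod (\<rho> g) (\<sigma> g)"

definition dual_act ::
    "nat \<Rightarrow> (complex mat \<Rightarrow> 'v::complex_vector \<Rightarrow> 'v) \<Rightarrow> complex mat \<Rightarrow> 'v dual \<Rightarrow> 'v dual"
  where "dual_act n \<rho> g f = Dual (\<lambda>v. dual_apply f (\<rho> (inv\<^bsub>GL n\<^esub> g) v))"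

definition ext_act :: "('g \<Rightarrow> 'v::complex_vector \<Rightarrow> 'v) \<Rightarrow> 'g \<Rightarrow> 'v ext \<Rightarrow> 'v ext"
  where "ext_act \<rho> g = ext_map (\<rho> g)"

definition submodule :: "'g set \<Rightarrow> ('g \<Rightarrow> 'v::complex_vector \<Rightarrow> 'v) \<Rightarrow> 'v set \<Rightarrow> bool"
  where "submodule G \<rho> W \<longleftrightarrow> cvec.subspace W \<and> (\<forall>g\<in>G. \<forall>w\<in>W. \<rho> g w \<in> W)"

definition irreducible_submodule :: "'g set \<Rightarrow> ('g \<Rightarrow> 'v::complex_vector \<Rightarrow> 'v) \<Rightarrow> 'v set \<Rightarrow> bool"
  where "irreducible_submodule G \<rho> W \<longleftrightarrow> submodule G \<rho> W \<and> W \<noteq> {0} \<and>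
    (\<forall>W'. submodule G \<rho> W' \<and> W' \<subseteq> W \<longrightarrow> W' = {0} \<or> W' = W)"

definition isomorphic_submodules ::
    "'g set \<Rightarrow> ('g \<Rightarrow> 'v::complex_vector \<Rightarrow> 'v) \<Rightarrow> 'v set \<Rightarrow> 'v set \<Rightarrow> bool"
  where "isomorphic_submodules G \<rho> W W' \<longleftrightarrow> (\<exists>\<phi>. bij_betw \<phi> W W' \<and>
    (\<forall>x\<in>W. \<forall>y\<in>W. \<phi> (x + y) = \<phi> x + \<phi> y) \<and>
    (\<forall>c. \<forall>x\<in>W. \<phi> (c *\<^sub>C x) = c *\<^sub>C \<phi> x) \<and>
    (\<forall>g\<in>G. \<forall>x\<in>W. \<phi> (\<rho> g x) = \<rho> g (\<phi> x)))"

text \<open>The whole space is the internal direct sum of the family \<open>U\<close> of subspaces.\<close>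

definition is_direct_sum :: "'i set \<Rightarrow> ('i \<Rightarrow> 'v::complex_vector set) \<Rightarrow> bool"
  where "is_direct_sum I U \<longleftrightarrow> finite I \<and> (\<forall>i\<in>I. cvec.subspace (U i)) \<and>
    (\<forall>x. \<exists>!f. f \<in> (\<Pi>\<^sub>E i\<in>I. U i) \<and> x = (\<Sum>i\<in>I. f i))"

definition multiplicity_free :: "'g set \<Rightarrow> ('g \<Rightarrow> 'v::complex_vector \<Rightarrow> 'v) \<Rightarrow> bool"
  where "multiplicity_free G \<rho> \<longleftrightarrow> (\<exists>S. is_direct_sum S (\<lambda>W. W) \<and>
    (\<forall>W\<in>S. irreducible_submodule G \<rho> W) \<and>
    (\<forall>W\<in>S. \<forall>W'\<in>S. W \<noteq> W' \<longrightarrow> \<not> isomorphic_submodules G \<rho> W W'))"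

definition skew_multiplicity_free :: "'g set \<Rightarrow> ('g \<Rightarrow> 'v::complex_vector \<Rightarrow> 'v) \<Rightarrow> bool"
  where "skew_multiplicity_free G \<rho> \<longleftrightarrow> multiplicity_free G (ext_act \<rho>)"

text \<open>
  The group \<open>\<complex>\<^sup>*\<close> is \<open>GL 1\<close>.  The element of \<open>(\<complex>\<^sup>*)\<^sup>l \<times> H\<^sub>1 \<times> \<dots> \<times> H\<^sub>k\<close> with torus
  components \<open>t 0, \<dots>, t (l - 1)\<close> and trivial components in all \<open>H\<^sub>i\<close>:
\<close>

definition torus_elem :: "nat \<Rightarrow> (nat \<times> complex mat set) list \<Rightarrow> (nat \<Rightarrow> complex) \<Rightarrow> complex mat"
  where "torus_elem l Hs t =
    diag_block_mat (map (\<lambda>i. mat 1 1 (\<lambda>_. t i)) [0..<l] @ map (\<lambda>(m, H). 1\<^sub>m m) Hs)"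

text \<open>
  \<open>\<phi>\<close> identifies \<open>(\<complex>\<^sup>*)\<^sup>l \<times> H\<^sub>1 \<times> \<dots> \<times> H\<^sub>k\<close> with \<open>G\<close>; the image of \<open>prod_group Qs\<close> is the
  factor \<open>H\<^sub>1 \<times> \<dots> \<times> H\<^sub>k\<close>, which has to be the commutator subgroup \<open>[G, G]\<close>.
\<close>

definition saturated ::
    "nat \<Rightarrow> complex mat set \<Rightarrow> (complex mat \<Rightarrow> 'v::complex_vector \<Rightarrow> 'v) \<Rightarrow> bool"
  where "saturated n G \<rho> \<longleftrightarrow> (\<exists>l U Hs \<phi>.
    is_direct_sum {..<l} U \<and>
    (\<forall>j<l. irreducible_submodule G \<rho> (U j)) \<and>
    (\<forall>(m, H)\<in>set Hs. simple_alg_group m H) \<and>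
    (let Ps = replicate l (1, carrier (GL 1)) @ Hs;
         Qs = replicate l (1, {1\<^sub>m 1}) @ Hs
     in alg_iso (prod_size Ps) (prod_group Ps) n G \<phi> \<and>
        \<phi> ` prod_group Qs = derived (GL n) G) \<and>
    (\<forall>j<l. \<forall>z. z \<noteq> 0 \<longrightarrow> (\<forall>i<l. \<forall>u\<in>U i.
        \<rho> (\<phi> (torus_elem l Hs ((\<lambda>_. 1)(j := z)))) u = (if i = j then z *\<^sub>C u else u))))"


section \<open>Well-definedness of the induced maps\<close>

lemma poly_mapping_decomp:
  fixes x :: "'k \<Rightarrow>\<^sub>0 complex"
  shows "x \<in> cvec.span (range (\<lambda>k. Poly_Mapping.single k 1))"
proof -
  have "x = (\<Sum>k\<in>Poly_Mapping.keys x. Poly_Mapping.lookup x k *\<^sub>C Poly_Mapping.single k 1)"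
  proof (rule poly_mapping_eqI)
    fix k :: 'k
    have "Poly_Mapping.lookup (c *\<^sub>C Poly_Mapping.single k' (1::complex)) k = (if k' = k then c else 0)"
      for c and k' :: 'k by transfer (simp add: scaleC_complex_def)
    then show "Poly_Mapping.lookup x k = Poly_Mapping.lookup
      (\<Sum>k\<in>Poly_Mapping.keys x. Poly_Mapping.lookup x k *\<^sub>C Poly_Mapping.single k 1) k"
      by (simp add: lookup_sum in_keys_iff)
  qed
  then show ?thesis
    by (metis (no_types, lifting) cvec.span_base cvec.span_scale cvec.span_sum rangeI)
qed

lemma span_range_wedge: "cvec.span (range wedge) = UNIV"
proof -
  have "abs_ext p \<in> cvec.span (range wedge)" for p :: "'a list \<Rightarrow>\<^sub>0 complex"
  proof (rule cvec.span_induct_alt[OF poly_mapping_decomp[of p]])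
    show "abs_ext 0 \<in> cvec.span (range (wedge :: 'a list \<Rightarrow> _))"
      by (metis cvec.span_zero zero_ext.abs_eq)
  next
    fix c :: complex and x y :: "'a list \<Rightarrow>\<^sub>0 complex"
    assume "x \<in> range (\<lambda>k. Poly_Mapping.single k 1)"
    then obtain k where x: "x = Poly_Mapping.single k 1" by blast
    assume "abs_ext y \<in> cvec.span (range wedge)"
    moreover have "abs_ext (c *\<^sub>C x + y) = c *\<^sub>C wedge k + abs_ext y"
      by (simp add: x wedge.abs_eq plus_ext.abs_eq scaleC_ext.abs_eq)
    ultimately show "abs_ext (c *\<^sub>C x + y) \<in> cvec.span (range wedge)"
      by (simp add: cvec.span_add cvec.span_scale cvec.span_base)
  qed
  moreover have "\<exists>p. x = abs_ext p" for x :: "'a ext"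
    by (metis Quotient3_abs_rep Quotient3_ext)
  ultimately show ?thesis by (metis UNIV_eq_I)
qed

lemma ext_map_ex1:
  fixes f :: "'v::complex_vector \<Rightarrow> 'w::complex_vector"
  assumes "clinear f"
  shows "\<exists>!h. clinear h \<and> (\<forall>vs. h (wedge vs) = wedge (map f vs))"
proof -
  define F :: "('v list \<Rightarrow>\<^sub>0 complex) \<Rightarrow> 'w ext" where
    "F p = (\<Sum>k\<in>Poly_Mapping.keys p. Poly_Mapping.lookup p k *\<^sub>C wedge (map f k))" for p
  have F_sup: "F p = (\<Sum>k\<in>K. Poly_Mapping.lookup p k *\<^sub>C wedge (map f k))"
    if "finite K" "Poly_Mapping.keys p \<subseteq> K" for p K
    unfolding F_def using that
    by (intro sum.mono_neutral_left) (auto simp: in_keys_iff)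
  have F_add: "F (p + q) = F p + F q" for p q
  proof -
    let ?K = "Poly_Mapping.keys p \<union> Poly_Mapping.keys q"
    have "Poly_Mapping.keys (p + q) \<subseteq> ?K" by (rule keys_add)
    then show ?thesis
      using F_sup[of ?K p] F_sup[of ?K q] F_sup[of ?K "p + q"]
      by (simp add: lookup_add scaleC_add_left sum.distrib)
  qed
  have F_scale: "F (c *\<^sub>C p) = c *\<^sub>C F p" for c p
  proof -
    have l: "Poly_Mapping.lookup (c *\<^sub>C p) k = c * Poly_Mapping.lookup p k" for k
      by transfer (simp add: scaleC_complex_def)
    have "Poly_Mapping.keys (c *\<^sub>C p) \<subseteq> Poly_Mapping.keys p"
      by (auto simp: in_keys_iff l)
    then show ?thesis
      using F_sup[of "Poly_Mapping.keys p" p] F_sup[of "Poly_Mapping.keys p" "c *\<^sub>C p"]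
      by (simp add: l cvec.scale_sum_right scaleC_scaleC)
  qed
  have F_zero: "F 0 = 0" by (simp add: F_def)
  have F_diff: "F (p - q) = F p - F q" for p q
    using F_add[of "p - q" q] by (simp add: eq_diff_eq)
  have F_single: "F (Poly_Mapping.single k 1) = wedge (map f k)" for k
    by (simp add: F_def scaleC_one)
  have f_add: "f (x + y) = f x + f y" and f_scale: "f (c *\<^sub>C x) = c *\<^sub>C f x" for x y c
    using assms by (auto simp: clinear_iff)
  have F_rel: "F r = 0" if "r \<in> ext_relations" for r
    using that
  proof cases
    case (add u v v' w)
    show ?thesis
      unfolding add F_diff F_single
      using wedge_add[of "map f u" "f v" "f v'" "map f w"] by (simp add: f_add)
  next
    case (scale u c v w)
    show ?thesis
      unfolding scale F_diff F_single F_scale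
      using wedge_scale[of "map f u" c "f v" "map f w"] by (simp add: f_scale)
  next
    case (square u v w)
    show ?thesis
      unfolding square F_single using wedge_square[of "map f u" "f v" "map f w"] by simp
  qed
  have F_span: "F r = 0" if "r \<in> cvec.span ext_relations" for r
    using that
    by (rule cvec.span_induct_alt) (simp_all add: F_add F_scale F_rel F_zero)
  have F_eq: "F p = F q" if "ext_eq p q" for p q
    using F_span[of "p - q"] that by (simp add: ext_eq_def F_diff)
  define h where "h x = F (rep_ext x)" for x
  have h_abs: "h (abs_ext p) = F p" for p
    unfolding h_def by (rule F_eq) (metis Quotient3_ext Quotient3_rep_abs equivp_ext_eq equivp_reflp)
  have "clinear h"
    unfolding clinear_iff
  proof (intro conjI allI)
    fix x y :: "'v ext" and c
    obtain p q where "x = abs_ext p" "y = abs_ext q"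
      by (metis Quotient3_abs_rep Quotient3_ext)
    then show "h (x + y) = h x + h y" "h (c *\<^sub>C x) = c *\<^sub>C h x"
      by (simp_all add: plus_ext.abs_eq scaleC_ext.abs_eq h_abs F_add F_scale)
  qed
  moreover have "\<forall>vs. h (wedge vs) = wedge (map f vs)"
    by (simp add: wedge.abs_eq h_abs F_single)
  moreover have "g = g'"
    if g: "clinear g" "\<forall>vs. g (wedge vs) = wedge (map f vs)"
      and g': "clinear g'" "\<forall>vs. g' (wedge vs) = wedge (map f vs)" for g g'
  proof
    fix x :: "'v ext"
    have "x \<in> cvec.span (range wedge)" by (simp add: span_range_wedge)
    then show "g x = g' x"
    proof (rule cvec.span_induct_alt)
      show "g 0 = g' 0"
        using g(1) g'(1) by (metis clinear_iff cvec.scale_zero_left)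
    next
      fix c and x y :: "'v ext"
      assume "x \<in> range wedge" "g y = g' y"
      then show "g (c *\<^sub>C x + y) = g' (c *\<^sub>C x + y)"
        using g g' by (auto simp: clinear_iff)
    qed
  qed
  ultimately show ?thesis by blast
qed

lemma
  assumes "clinear f"
  shows clinear_ext_map: "clinear (ext_map f)"
    and ext_map_wedge: "ext_map f (wedge vs) = wedge (map f vs)"
  using theI'[OF ext_map_ex1[OF assms]] unfolding ext_map_def by blast+

end

theory Submission
  imports Defs
begin

text \<open>
  The exterior algebras of \<open>V\<^sub>1 \<oplus> V\<^sub>2\<close> and of \<open>V\<^sub>1 \<oplus> V\<^sub>2\<^sup>*\<close> are the same \<open>G\<close>-module up to a
  twist by a character.  Behind this is the classical isomorphism
  \<open>\<And>\<^sup>k V\<^sub>2\<^sup>* \<cong> \<And>\<^sup>m\<^sup>-\<^sup>k V\<^sub>2 \<otimes> det\<^sup>-\<^sup>1\<close> for \<open>m = dim V\<^sub>2\<close>, tensored with \<open>\<And>V\<^sub>1\<close>.  A twist by a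
  character changes neither the submodules nor the isomorphisms between them, so that it
  preserves multiplicity-freeness (\<open>multiplicity_free_twist\<close>).

  The isomorphism is built without tensor products and without choosing a basis of the exterior
  algebra.  Let \<open>\<omega>\<close> be the wedge product of a basis of \<open>V\<^sub>2\<close>.  A pair \<open>(v, f)\<close> in
  \<open>V\<^sub>1 \<oplus> V\<^sub>2\<^sup>*\<close> acts on \<open>\<And>(V\<^sub>1 \<oplus> V\<^sub>2)\<close> by the operator
  \<open>x \<mapsto> v \<and> x + \<iota>\<^sub>f x\<close>, whose square vanishes because its two parts
  square to zero and, as \<open>f\<close> vanishes on \<open>V\<^sub>1\<close>, anticommute.  Hence these
  operators define an action of the algebra \<open>\<And>(V\<^sub>1 \<oplus> V\<^sub>2\<^sup>*)\<close>, and letting it act on \<open>\<omega>\<close> gives a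
  linear map \<open>\<Phi>\<close> (\<open>duality\<close>) into \<open>\<And>(V\<^sub>1 \<oplus> V\<^sub>2)\<close>.  It exchanges multiplication
  by \<open>f\<close> with contraction by \<open>f\<close>, and contraction by \<open>w \<in> V\<^sub>2\<close> with multiplication by \<open>w\<close>.
  Exchanging \<open>V\<^sub>2\<close> and \<open>V\<^sub>2\<^sup>*\<close> gives a map \<open>\<Psi>\<close> in the other direction; \<open>\<Psi> \<circ> \<Phi>\<close> commutes with all
  multiplications and fixes \<open>1\<close>, so it is the identity (\<open>duality_inverse\<close>).  Finally
  \<open>g \<in> G\<close> respects products and contractions and multiplies \<open>\<omega>\<close> by a
  scalar \<open>c\<close> (\<open>volume_eigenvector\<close>), so that \<open>g \<Phi>(x) = c \<Phi>(g x)\<close>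
  (\<open>duality_equivariant\<close>).
\<close>

section \<open>Linear maps out of the exterior algebra\<close>

lemma clinear_add: "clinear f \<Longrightarrow> f (x + y) = f x + f y"
  and clinear_scale: "clinear f \<Longrightarrow> f (c *\<^sub>C x) = c *\<^sub>C f x"
  by (simp_all add: clinear_iff)

lemma clinear_zero: "clinear f \<Longrightarrow> f 0 = 0"
  by (metis clinear_scale cvec.scale_zero_left)

lemma clinear_diff: "clinear f \<Longrightarrow> f (x - y) = f x - f y"
  by (metis clinear_add diff_add_cancel add_diff_cancel_right')

lemmas clinear_simps = clinear_add clinear_scale clinear_zero clinear_diff

lemma clinear_foldr:
  assumes "\<And>u. clinear (T u)"
  shows "clinear (foldr T us)"
proof (induction us)
  case (Cons u us)
  then show ?case
    using assms[of u] by (simp add: clinear_iff)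
qed (simp add: clinear_iff)

text \<open>
  The universal property: \<open>F\<close> extends linearly to the free space on words, and the hypotheses say
  that this extension kills the defining relations of the exterior algebra.
\<close>

lemma ext_lift_ex:
  fixes F :: "'u::complex_vector list \<Rightarrow> 'e::complex_vector"
  assumes add: "\<And>u v v' w. F (u @ [v + v'] @ w) = F (u @ [v] @ w) + F (u @ [v'] @ w)"
    and scale: "\<And>u c v w. F (u @ [c *\<^sub>C v] @ w) = c *\<^sub>C F (u @ [v] @ w)"
    and square: "\<And>u v w. F (u @ [v, v] @ w) = 0"
  shows "\<exists>h. clinear h \<and> (\<forall>us. h (wedge us) = F us)"
proof -
  define H :: "('u list \<Rightarrow>\<^sub>0 complex) \<Rightarrow> 'e" where
    "H p = (\<Sum>k\<in>Poly_Mapping.keys p. Poly_Mapping.lookup p k *\<^sub>C F k)" for p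
  have H_sup: "H p = (\<Sum>k\<in>K. Poly_Mapping.lookup p k *\<^sub>C F k)"
    if "finite K" "Poly_Mapping.keys p \<subseteq> K" for p K
    unfolding H_def using that
    by (intro sum.mono_neutral_left) (auto simp: in_keys_iff)
  have "clinear H"
    unfolding clinear_iff
  proof (intro conjI allI)
    fix p q :: "'u list \<Rightarrow>\<^sub>0 complex" and c
    let ?K = "Poly_Mapping.keys p \<union> Poly_Mapping.keys q"
    have "Poly_Mapping.keys (p + q) \<subseteq> ?K"
      by (rule keys_add)
    then show "H (p + q) = H p + H q"
      using H_sup[of ?K p] H_sup[of ?K q] H_sup[of ?K "p + q"]
      by (simp add: lookup_add scaleC_add_left sum.distrib)
    have l: "Poly_Mapping.lookup (c *\<^sub>C p) k = c * Poly_Mapping.lookup p k" for k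
      by transfer (simp add: scaleC_complex_def)
    have "Poly_Mapping.keys (c *\<^sub>C p) \<subseteq> Poly_Mapping.keys p"
      by (auto simp: in_keys_iff l)
    then show "H (c *\<^sub>C p) = c *\<^sub>C H p"
      using H_sup[of "Poly_Mapping.keys p" p] H_sup[of "Poly_Mapping.keys p" "c *\<^sub>C p"]
      by (simp add: l cvec.scale_sum_right scaleC_scaleC)
  qed
  note H = clinear_simps[OF this]
  have H_single: "H (Poly_Mapping.single k 1) = F k" for k
    by (simp add: H_def scaleC_one)
  have H_rel: "H r = 0" if "r \<in> ext_relations" for r
    using that by cases (simp_all add: H H_single add[simplified] scale[simplified] square[simplified])
  have H_span: "H r = 0" if "r \<in> cvec.span ext_relations" for r
    using that by (rule cvec.span_induct_alt) (simp_all add: H H_rel)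
  define h where "h x = H (rep_ext x)" for x
  have h_abs: "h (abs_ext p) = H p" for p
  proof -
    have "ext_eq (rep_ext (abs_ext p)) p"
      by (metis Quotient3_ext Quotient3_rep_abs equivp_ext_eq equivp_reflp)
    then show ?thesis
      using H_span[of "rep_ext (abs_ext p) - p"] by (simp add: ext_eq_def H h_def)
  qed
  have "clinear h"
    unfolding clinear_iff
  proof (intro conjI allI)
    fix x y :: "'u ext" and c
    obtain p q where "x = abs_ext p" "y = abs_ext q"
      by (metis Quotient3_abs_rep Quotient3_ext)
    then show "h (x + y) = h x + h y" "h (c *\<^sub>C x) = c *\<^sub>C h x"
      by (simp_all add: plus_ext.abs_eq scaleC_ext.abs_eq h_abs H)
  qed
  moreover have "\<forall>us. h (wedge us) = F us"
    by (simp add: wedge.abs_eq h_abs H_single)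
  ultimately show ?thesis by blast
qed

definition ext_lmul :: "'u::complex_vector \<Rightarrow> 'u ext \<Rightarrow> 'u ext"
  where "ext_lmul u = (SOME h. clinear h \<and> (\<forall>us. h (wedge us) = wedge (u # us)))"

lemma
  shows clinear_ext_lmul: "clinear (ext_lmul u)"
    and ext_lmul_wedge: "ext_lmul u (wedge us) = wedge (u # us)"
proof -
  have "\<exists>h. clinear h \<and> (\<forall>us. h (wedge us) = wedge (u # us))"
  proof (rule ext_lift_ex)
    fix u' v v' w and c :: complex
    show "wedge (u # u' @ [v + v'] @ w) = wedge (u # u' @ [v] @ w) + wedge (u # u' @ [v'] @ w)"
      using wedge_add[of "u # u'" v v' w] by simp
    show "wedge (u # u' @ [c *\<^sub>C v] @ w) = c *\<^sub>C wedge (u # u' @ [v] @ w)"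
      using wedge_scale[of "u # u'" c v w] by simp
    show "wedge (u # u' @ [v, v] @ w) = 0"
      using wedge_square[of "u # u'" v w] by simp
  qed
  from someI_ex[OF this]
  show "clinear (ext_lmul u)" "ext_lmul u (wedge us) = wedge (u # us)"
    unfolding ext_lmul_def by blast+
qed

lemmas ext_lmul_simps = clinear_simps[OF clinear_ext_lmul]

lemma foldr_ext_lmul: "foldr ext_lmul us (wedge []) = wedge us"
  by (induction us) (simp_all add: ext_lmul_wedge)

text \<open>
  The exterior algebra is spanned by iterated left multiples of \<open>1\<close>, which is \<open>wedge []\<close>.  Induction
  over this generation replaces explicit computations with words.
\<close>

lemma ext_induct [case_names one lmul add scale]:
  fixes x :: "'u::complex_vector ext"
  assumes one: "P (wedge [])"
    and lmul: "\<And>u x. P x \<Longrightarrow> P (ext_lmul u x)"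
    and add: "\<And>x y. P x \<Longrightarrow> P y \<Longrightarrow> P (x + y)"
    and scale: "\<And>c x. P x \<Longrightarrow> P (c *\<^sub>C x)"
  shows "P x"
proof -
  have word: "P (wedge us)" for us
    by (induction us) (use one lmul in \<open>auto simp flip: ext_lmul_wedge\<close>)
  have "x \<in> cvec.span (range wedge)"
    by (simp add: span_range_wedge)
  then show ?thesis
  proof (rule cvec.span_induct_alt)
    show "P 0"
      using scale[OF one, of 0] by simp
  qed (use word add scale in blast)
qed

lemma ext_lmul_add_left: "ext_lmul (u + v) x = ext_lmul u x + ext_lmul v x"
  and ext_lmul_scale_left: "ext_lmul (c *\<^sub>C u) x = c *\<^sub>C ext_lmul u x"
  and ext_lmul_square: "ext_lmul u (ext_lmul u x) = 0"
  for u v :: "'u::complex_vector"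
proof -
  have x: "x \<in> cvec.span (range wedge)"
    by (simp add: span_range_wedge)
  show "ext_lmul (u + v) x = ext_lmul u x + ext_lmul v x"
    using x
  proof (rule cvec.span_induct_alt)
    fix c and y z :: "'u ext"
    assume "y \<in> range wedge" and z: "ext_lmul (u + v) z = ext_lmul u z + ext_lmul v z"
    then obtain us where "y = wedge us" by blast
    then show "ext_lmul (u + v) (c *\<^sub>C y + z) = ext_lmul u (c *\<^sub>C y + z) + ext_lmul v (c *\<^sub>C y + z)"
      using wedge_add[of "[]" u v us] by (simp add: ext_lmul_simps ext_lmul_wedge z scaleC_add_right)
  qed (simp add: ext_lmul_simps)
  show "ext_lmul (c *\<^sub>C u) x = c *\<^sub>C ext_lmul u x"
    using x
  proof (rule cvec.span_induct_alt)
    fix d and y z :: "'u ext"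
    assume "y \<in> range wedge" and z: "ext_lmul (c *\<^sub>C u) z = c *\<^sub>C ext_lmul u z"
    then obtain us where "y = wedge us" by blast
    then show "ext_lmul (c *\<^sub>C u) (d *\<^sub>C y + z) = c *\<^sub>C ext_lmul u (d *\<^sub>C y + z)"
      using wedge_scale[of "[]" c u us]
      by (simp add: ext_lmul_simps ext_lmul_wedge z scaleC_add_right scaleC_scaleC mult.commute)
  qed (simp add: ext_lmul_simps)
  show "ext_lmul u (ext_lmul u x) = 0"
    using x
  proof (rule cvec.span_induct_alt)
    fix d and y z :: "'u ext"
    assume "y \<in> range wedge" and z: "ext_lmul u (ext_lmul u z) = 0"
    then obtain us where "y = wedge us" by blast
    then show "ext_lmul u (ext_lmul u (d *\<^sub>C y + z)) = 0"
      using wedge_square[of "[]" u us] by (simp add: ext_lmul_simps ext_lmul_wedge z)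
  qed (simp add: ext_lmul_simps)
qed

lemma ext_lmul_zero_left: "ext_lmul 0 x = 0"
  using ext_lmul_scale_left[of 0 0 x] by simp

lemma ext_lmul_anticommute: "ext_lmul u (ext_lmul v x) = - ext_lmul v (ext_lmul u x)"
  using ext_lmul_square[of "u + v" x]
  by (simp add: ext_lmul_add_left ext_lmul_simps ext_lmul_square eq_neg_iff_add_eq_0
      add.commute)

lemma ext_map_lmul:
  assumes "clinear g"
  shows "ext_map g (ext_lmul u x) = ext_lmul (g u) (ext_map g x)"
proof -
  note g = clinear_simps[OF clinear_ext_map[OF assms]]
  have "x \<in> cvec.span (range wedge)"
    by (simp add: span_range_wedge)
  then show ?thesis
    by (rule cvec.span_induct_alt)
      (auto simp: g ext_lmul_simps ext_lmul_wedge ext_map_wedge[OF assms])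
qed

text \<open>
  Under the condition \<open>square_zero_rep T\<close> below, \<open>T\<close> makes \<open>'e\<close> a module over the exterior
  algebra of \<open>'u\<close>; then \<open>ext_fold T e\<close> is the orbit map \<open>x \<mapsto> x \<cdot> e\<close>.
\<close>

definition ext_fold :: "('u::complex_vector \<Rightarrow> 'e::complex_vector \<Rightarrow> 'e) \<Rightarrow> 'e \<Rightarrow> 'u ext \<Rightarrow> 'e"
  where "ext_fold T e = (SOME h. clinear h \<and> (\<forall>us. h (wedge us) = foldr T us e))"

definition square_zero_rep :: "('u::complex_vector \<Rightarrow> 'e::complex_vector \<Rightarrow> 'e) \<Rightarrow> bool"
  where "square_zero_rep T \<longleftrightarrow> (\<forall>u. clinear (T u)) \<and> (\<forall>x. clinear (\<lambda>u. T u x)) \<and>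
    (\<forall>u x. T u (T u x) = 0)"

lemma
  assumes "square_zero_rep T"
  shows clinear_ext_fold: "clinear (ext_fold T e)"
    and ext_fold_wedge: "ext_fold T e (wedge us) = foldr T us e"
proof -
  have T: "clinear (T u)" "clinear (\<lambda>u. T u x)" "T u (T u x) = 0" for u x
    using assms by (simp_all add: square_zero_rep_def)
  note fold = clinear_simps[OF clinear_foldr[of T, OF T(1)]]
  have "\<exists>h. clinear h \<and> (\<forall>us. h (wedge us) = foldr T us e)"
    by (rule ext_lift_ex)
      (simp_all add: fold T(3) clinear_add[OF T(2)] clinear_scale[OF T(2)])
  from someI_ex[OF this]
  show "clinear (ext_fold T e)" "ext_fold T e (wedge us) = foldr T us e"
    unfolding ext_fold_def by blast+
qed

lemma ext_fold_lmul:
  assumes "square_zero_rep T"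
  shows "ext_fold T e (ext_lmul u x) = T u (ext_fold T e x)"
proof -
  have T: "clinear (T u)"
    using assms by (simp add: square_zero_rep_def)
  have "x \<in> cvec.span (range wedge)"
    by (simp add: span_range_wedge)
  then show ?thesis
    by (rule cvec.span_induct_alt)
      (auto simp: clinear_simps[OF clinear_ext_fold[OF assms]] clinear_simps[OF T]
        ext_lmul_simps ext_lmul_wedge ext_fold_wedge[OF assms])
qed

section \<open>Contraction by a linear functional\<close>

text \<open>
  Contraction is determined by \<open>\<iota>\<^sub>f 1 = 0\<close> and \<open>\<iota>\<^sub>f (u \<and> x) = f u x - u \<and> \<iota>\<^sub>f x\<close>.  This recursion uses
  \<open>x\<close> as well as \<open>\<iota>\<^sub>f x\<close>, so it is run on the pair \<open>(x, \<iota>\<^sub>f x)\<close>, where its steps square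
  to zero.
\<close>

definition contract_step ::
    "('u::complex_vector \<Rightarrow> complex) \<Rightarrow> 'u \<Rightarrow> 'u ext \<times> 'u ext \<Rightarrow> 'u ext \<times> 'u ext"
  where "contract_step f u p = (ext_lmul u (fst p), f u *\<^sub>C fst p - ext_lmul u (snd p))"

definition contract :: "('u::complex_vector \<Rightarrow> complex) \<Rightarrow> 'u ext \<Rightarrow> 'u ext"
  where "contract f x = snd (ext_fold (contract_step f) (wedge [], 0) x)"

lemma fst_scaleC [simp]: "fst (c *\<^sub>C p) = c *\<^sub>C fst p"
  and snd_scaleC [simp]: "snd (c *\<^sub>C p) = c *\<^sub>C snd p"
  by (simp_all add: scaleC_prod_def)

lemma square_zero_rep_contract_step:
  assumes "clinear f"
  shows "square_zero_rep (contract_step f)"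
  unfolding square_zero_rep_def clinear_iff contract_step_def
  by (simp add: prod_eq_iff ext_lmul_simps ext_lmul_add_left ext_lmul_scale_left ext_lmul_square
      clinear_simps[OF assms] scaleC_complex_def algebra_simps scaleC_add_left scaleC_add_right
      scaleC_scaleC cvec.scale_right_diff_distrib)

lemma
  assumes "clinear f"
  shows clinear_contract: "clinear (contract f)"
    and contract_one: "contract f (wedge []) = 0"
    and contract_lmul: "contract f (ext_lmul u x) = f u *\<^sub>C x - ext_lmul u (contract f x)"
proof -
  note rep = square_zero_rep_contract_step[OF assms]
  show "clinear (contract f)"
    using clinear_ext_fold[OF rep, of "(wedge [], 0)"]
    by (simp add: clinear_iff contract_def)
  show "contract f (wedge []) = 0"
    by (simp add: contract_def ext_fold_wedge[OF rep])
  have "fst (contract_step f u p) = ext_lmul u (fst p)" for u p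
    by (simp add: contract_step_def)
  then have "fst (ext_fold (contract_step f) (wedge [], 0) x) = x"
    by (induction x rule: ext_induct)
      (simp_all add: ext_fold_wedge[OF rep] ext_fold_lmul[OF rep]
        clinear_simps[OF clinear_ext_fold[OF rep]])
  then show "contract f (ext_lmul u x) = f u *\<^sub>C x - ext_lmul u (contract f x)"
    by (simp add: contract_def ext_fold_lmul[OF rep] contract_step_def)
qed

lemma contract_square:
  assumes "clinear f"
  shows "contract f (contract f x) = 0"
  by (induction x rule: ext_induct)
    (simp_all add: clinear_simps[OF clinear_contract[OF assms]] contract_one[OF assms]
      contract_lmul[OF assms] ext_lmul_simps)

lemma contract_add_left:
  assumes "clinear f" "clinear g" "clinear (\<lambda>u. f u + g u)"
  shows "contract (\<lambda>u. f u + g u) x = contract f x + contract g x"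
  by (induction x rule: ext_induct)
    (simp_all add: assms clinear_simps[OF clinear_contract] contract_one
      contract_lmul ext_lmul_simps scaleC_add_left scaleC_add_right)

lemma contract_scale_left:
  assumes "clinear f" "clinear (\<lambda>u. c * f u)"
  shows "contract (\<lambda>u. c * f u) x = c *\<^sub>C contract f x"
  by (induction x rule: ext_induct)
    (simp_all add: assms clinear_simps[OF clinear_contract] contract_one
      contract_lmul ext_lmul_simps scaleC_add_right scaleC_scaleC mult.commute
      cvec.scale_right_diff_distrib)

lemma ext_map_contract:
  assumes "clinear g" "clinear f" "clinear (\<lambda>u. f (g u))"
  shows "contract f (ext_map g x) = ext_map g (contract (\<lambda>u. f (g u)) x)"
  by (induction x rule: ext_induct)
    (simp_all add: assms clinear_simps[OF clinear_contract] clinear_simps[OF clinear_ext_map]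
      contract_one contract_lmul ext_map_wedge ext_map_lmul ext_lmul_simps)

text \<open>
  Iterated, this shows that contracting an element of degree \<open>k\<close> by \<open>k\<close> functionals leaves a
  multiple of \<open>1\<close>.
\<close>

lemma contract_words:
  assumes "clinear f" and "x \<in> cvec.span (wedge ` {us. length us = Suc k})"
  shows "contract f x \<in> cvec.span (wedge ` {us. length us = k})"
  using assms(2)
proof (rule cvec.span_induct_alt)
  note lin = clinear_simps[OF clinear_contract[OF assms(1)]]
  show "contract f 0 \<in> cvec.span (wedge ` {us. length us = k})"
    by (simp add: lin cvec.span_zero)
  have word: "contract f (wedge us) \<in> cvec.span (wedge ` {us. length us = k})"
    if "length us = Suc k" for us :: "'a list" and k
    using that
  proof (induction us arbitrary: k)
    case (Cons u us)
    have lmul: "ext_lmul u y \<in> cvec.span (wedge ` {us. length us = Suc m})"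
      if "y \<in> cvec.span (wedge ` {us. length us = m})" for y m
      using that
    proof (rule cvec.span_induct_alt)
      fix c y z
      assume "y \<in> wedge ` {us :: 'a list. length us = m}"
        and z: "ext_lmul u z \<in> cvec.span (wedge ` {us. length us = Suc m})"
      then have "ext_lmul u y \<in> wedge ` {us. length us = Suc m}"
        by (auto simp: ext_lmul_wedge)
      then show "ext_lmul u (c *\<^sub>C y + z) \<in> cvec.span (wedge ` {us. length us = Suc m})"
        using z by (simp add: ext_lmul_simps cvec.span_add cvec.span_scale cvec.span_base)
    qed (simp add: ext_lmul_simps cvec.span_zero)
    have "ext_lmul u (contract f (wedge us)) \<in> cvec.span (wedge ` {us. length us = k})"
    proof (cases us)
      case Nil
      then show ?thesis
        by (simp add: contract_one[OF assms(1)] ext_lmul_simps cvec.span_zero)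
    next
      case (Cons u' us')
      then have "length us = Suc (k - 1)" "k = Suc (k - 1)"
        using Cons.prems by auto
      then show ?thesis
        using lmul[OF Cons.IH[of "k - 1"]] by simp
    qed
    moreover have "wedge us \<in> cvec.span (wedge ` {us. length us = k})"
      using Cons.prems by (intro cvec.span_base) auto
    ultimately show ?case
      by (simp add: contract_lmul[OF assms(1)] cvec.span_diff cvec.span_scale flip: ext_lmul_wedge)
  qed simp
  fix c and y z :: "'a ext"
  assume "y \<in> wedge ` {us. length us = Suc k}"
    and "contract f z \<in> cvec.span (wedge ` {us. length us = k})"
  then show "contract f (c *\<^sub>C y + z) \<in> cvec.span (wedge ` {us. length us = k})"
    using word by (auto simp: lin intro!: cvec.span_add cvec.span_scale)
qed

section \<open>The duality map between two exterior algebras\<close>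

text \<open>
  A perfect pairing of two spaces with dual bases, listed in order.  Keeping the two spaces abstract makes
  the situation symmetric, so that the inverse of the duality map is another instance of
  the same construction.
\<close>

locale dual_bases =
  fixes p :: "'a::complex_vector \<Rightarrow> 'b::complex_vector \<Rightarrow> complex"
    and as :: "'a list" and bs :: "'b list"
  assumes p_right: "clinear (p a)"
    and p_left: "clinear (\<lambda>a. p a b)"
    and length_eq: "length as = length bs"
    and biorthogonal: "\<lbrakk>i < length bs; j < length bs\<rbrakk> \<Longrightarrow> p (as ! i) (bs ! j) = (if i = j then 1 else 0)"
    and span_as: "cvec.span (set as) = UNIV"
    and span_bs: "cvec.span (set bs) = UNIV"
begin

text \<open>
  The lists are reversed so that no sign appears later on: contracting
  \<open>b\<^sub>1 \<and> \<dots> \<and> b\<^sub>m\<close> first by \<open>a\<^sub>1\<close> and last by \<open>a\<^sub>m\<close> gives \<open>1\<close>, and so does contracting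
  \<open>a\<^sub>m \<and> \<dots> \<and> a\<^sub>1\<close> first by \<open>b\<^sub>m\<close> and last by \<open>b\<^sub>1\<close>.
\<close>

lemma flipped: "dual_bases (\<lambda>b a. p a b) (rev bs) (rev as)"
  by (rule dual_bases.intro)
    (use p_left p_right length_eq biorthogonal span_as span_bs in \<open>auto simp: rev_nth\<close>)

lemma p_snd: "clinear (\<lambda>q. p a (snd q))"
  using p_right[of a] by (simp add: clinear_iff)

definition volume :: "('v::complex_vector \<times> 'b) ext"
  where "volume = wedge (map (Pair 0) bs)"

abbreviation interior :: "'a \<Rightarrow> ('v::complex_vector \<times> 'b) ext \<Rightarrow> ('v \<times> 'b) ext"
  where "interior a \<equiv> contract (\<lambda>q. p a (snd q))"

abbreviation exterior :: "'b \<Rightarrow> ('v::complex_vector \<times> 'b) ext \<Rightarrow> ('v \<times> 'b) ext"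
  where "exterior b \<equiv> ext_lmul (0, b)"

definition mixed :: "'v::complex_vector \<times> 'a \<Rightarrow> ('v \<times> 'b) ext \<Rightarrow> ('v \<times> 'b) ext"
  where "mixed q x = ext_lmul (fst q, 0) x + interior (snd q) x"

lemmas interior_simps = clinear_simps[OF clinear_contract[OF p_snd]]
lemmas interior_lmul = contract_lmul[OF p_snd]

lemma interior_add_left: "interior (a + a') x = interior a x + interior a' x"
  using contract_add_left[OF p_snd p_snd, of a a' x] p_snd[of "a + a'"]
  by (simp add: clinear_add[OF p_left])

lemma interior_scale_left: "interior (c *\<^sub>C a) x = c *\<^sub>C interior a x"
  using contract_scale_left[OF p_snd, of c a x] p_snd[of "c *\<^sub>C a"]
  by (simp add: clinear_scale[OF p_left] scaleC_complex_def)

lemma interior_zero_left: "interior 0 x = 0"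
  using interior_scale_left[of 0 0 x] by simp

text \<open>
  Multiplication by \<open>(v, 0)\<close> and contraction by \<open>a\<close> square to zero, and they anticommute because
  the functional \<open>a\<close> vanishes on \<open>(v, 0)\<close>.
\<close>

lemma square_zero_rep_mixed: "square_zero_rep (mixed :: 'v::complex_vector \<times> 'a \<Rightarrow> _)"
proof -
  have add: "ext_lmul (v + v', 0) x = ext_lmul (v, 0) x + ext_lmul (v', 0) x"
    for v v' :: 'v and x :: "('v \<times> 'b) ext"
    using ext_lmul_add_left[of "(v, 0)" "(v', 0)"] by simp
  have scale: "ext_lmul (c *\<^sub>C v, 0) x = c *\<^sub>C ext_lmul (v, 0) x"
    for c and v :: 'v and x :: "('v \<times> 'b) ext"
    using ext_lmul_scale_left[of c "(v, 0)"] by (simp add: scaleC_prod_def)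
  show ?thesis
    unfolding square_zero_rep_def mixed_def
    by (auto simp: clinear_iff interior_simps interior_lmul ext_lmul_simps ext_lmul_square add scale
        interior_add_left interior_scale_left scaleC_add_right clinear_zero[OF p_right]
        contract_square[OF p_snd])
qed

definition duality :: "('v::complex_vector \<times> 'a) ext \<Rightarrow> ('v \<times> 'b) ext"
  where "duality = ext_fold mixed volume"

lemma clinear_duality: "clinear duality"
  and duality_one: "duality (wedge []) = volume"
  and duality_lmul: "duality (ext_lmul q x) = mixed q (duality x)"
  unfolding duality_def
  by (simp_all add: clinear_ext_fold ext_fold_wedge ext_fold_lmul square_zero_rep_mixed)

lemmas duality_simps = clinear_simps[OF clinear_duality]

lemma exterior_kills_if_basis:
  assumes "\<And>b. b \<in> set bs \<Longrightarrow> exterior b x = 0"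
  shows "exterior b x = 0"
proof -
  have "b \<in> cvec.span (set bs)"
    by (simp add: span_bs)
  then show ?thesis
  proof (rule cvec.span_induct_alt)
    show "exterior 0 x = 0"
      using ext_lmul_zero_left[of x] by (simp add: zero_prod_def)
    fix c b b'
    assume "b \<in> set bs" "exterior b' x = 0"
    then show "exterior (c *\<^sub>C b + b') x = 0"
      using ext_lmul_add_left[of "(0, c *\<^sub>C b)" "(0, b')" x] ext_lmul_scale_left[of c "(0, b)" x]
      by (simp add: assms scaleC_prod_def)
  qed
qed

lemma exterior_volume: "exterior b (volume :: ('v::complex_vector \<times> 'b) ext) = 0"
proof (rule exterior_kills_if_basis)
  have "ext_lmul u (wedge us) = 0" if "u \<in> set us" for u :: "'v \<times> 'b" and us
    using that
  proof (induction us)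
    case (Cons u' us)
    then show ?case
      using ext_lmul_anticommute[of u u' "wedge us"]
      by (auto simp: ext_lmul_square ext_lmul_simps simp flip: ext_lmul_wedge)
  qed simp
  then show "exterior b (volume :: ('v \<times> 'b) ext) = 0" if "b \<in> set bs" for b
    using that by (simp add: volume_def)
qed

text \<open>
  Both sides vanish at \<open>1\<close>, since \<open>b \<and> \<omega> = 0\<close> in top degree.  The induction step holds because
  multiplication by \<open>b\<close> anticommutes with the operator of \<open>(v, a)\<close> up to the scalar \<open>p a b\<close>,
  which is the rule for contraction.
\<close>

lemma duality_contract:
  "duality (contract (\<lambda>q. p (snd q) b) x) = exterior b (duality x)"
proof -
  have pb: "clinear (\<lambda>q. p (snd q) b)"
    using p_left[of b] by (simp add: clinear_iff)
  show ?thesis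
  proof (induction x rule: ext_induct)
    case one
    then show ?case
      by (simp add: contract_one[OF pb] duality_simps duality_one exterior_volume)
  next
    case (lmul q x)
    have "exterior b (mixed q y) = p (snd q) b *\<^sub>C y - mixed q (exterior b y)" for y
      using ext_lmul_anticommute[of "(0, b)" "(fst q, 0)" y]
      by (simp add: mixed_def ext_lmul_simps interior_lmul)
    with lmul show ?case
      by (simp add: contract_lmul[OF pb] duality_simps duality_lmul)
  qed (simp_all add: clinear_simps[OF clinear_contract[OF pb]] duality_simps ext_lmul_simps)
qed

lemma interior_volume: "fold interior as (volume :: ('v::complex_vector \<times> 'b) ext) = wedge []"
proof -
  have "fold interior as' (wedge (map (Pair 0) bs')) = (wedge [] :: ('v \<times> 'b) ext)"
    if "length as' = length bs'"
      "\<And>i j. i < length bs' \<Longrightarrow> j < length bs' \<Longrightarrow> p (as' ! i) (bs' ! j) = (if i = j then 1 else 0)"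
    for as' bs'
    using that
  proof (induction as' bs' rule: list_induct2)
    case (Cons a as b bs)
    have ab: "p a b = 1"
      using Cons.prems[of 0 0] by simp
    have abs: "p a b' = 0" if "b' \<in> set bs" for b'
      using that Cons.prems[of 0 "Suc _"] by (fastforce simp: in_set_conv_nth)
    have "interior a (wedge (map (Pair 0) cs)) = (0 :: ('v \<times> 'b) ext)" if "\<forall>b'\<in>set cs. p a b' = 0" for cs
      using that
      by (induction cs) (simp_all add: contract_one[OF p_snd] interior_lmul ext_lmul_simps flip: ext_lmul_wedge)
    then have "interior a (wedge (map (Pair 0) (b # bs))) = (wedge (map (Pair 0) bs) :: ('v \<times> 'b) ext)"
      using abs by (simp add: interior_lmul ab ext_lmul_simps scaleC_one flip: ext_lmul_wedge)
    moreover have "fold interior as (wedge (map (Pair 0) bs)) = (wedge [] :: ('v \<times> 'b) ext)"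
      by (rule Cons.IH) (use Cons.prems[of "Suc _" "Suc _"] in auto)
    ultimately show ?case by simp
  qed simp
  then show ?thesis
    using length_eq biorthogonal by (simp add: volume_def)
qed

text \<open>
  If \<open>b\<^sub>1 \<and> y = 0\<close>, then \<open>p a\<^sub>1 b\<^sub>1 = 1\<close> and the contraction rule give \<open>y = b\<^sub>1 \<and> \<iota>\<^bsub>a\<^sub>1\<^esub> y\<close>, and the
  vectors \<open>b\<^sub>2, \<dots>, b\<^sub>m\<close>, being orthogonal to \<open>a\<^sub>1\<close>, still kill \<open>\<iota>\<^bsub>a\<^sub>1\<^esub> y\<close>.  Iterating splits off the whole volume element.
\<close>

lemma killed_by_exterior:
  assumes "\<And>b. exterior b y = 0"
  shows "y = foldr exterior bs (fold interior as y)"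
proof -
  have "y = foldr exterior bs' (fold interior as' y)"
    if "length as' = length bs'"
      "\<And>i j. i < length bs' \<Longrightarrow> j < length bs' \<Longrightarrow> p (as' ! i) (bs' ! j) = (if i = j then 1 else 0)"
      "\<And>b. b \<in> set bs' \<Longrightarrow> exterior b y = 0"
    for as' bs' y
    using that
  proof (induction as' bs' arbitrary: y rule: list_induct2)
    case (Cons a as b bs)
    have anti: "exterior b' (interior a y) = p a b' *\<^sub>C y" if "exterior b' y = 0" for b'
      using interior_lmul[of a "(0, b')" y] that by (simp add: interior_simps)
    have ab: "p a b = 1"
      using Cons.prems(1)[of 0 0] by simp
    have abs: "p a b' = 0" if "b' \<in> set bs" for b'
      using that Cons.prems(1)[of 0 "Suc _"] by (fastforce simp: in_set_conv_nth)
    have "interior a y = foldr exterior bs (fold interior as (interior a y))"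
    proof (rule Cons.IH)
      show "p (as ! i) (bs ! j) = (if i = j then 1 else 0)" if "i < length bs" "j < length bs" for i j
        using Cons.prems(1)[of "Suc i" "Suc j"] that by simp
      show "exterior b' (interior a y) = 0" if "b' \<in> set bs" for b'
        using that anti[of b'] Cons.prems(2)[of b'] by (simp add: abs)
    qed
    moreover have "y = exterior b (interior a y)"
      using anti[of b] Cons.prems(2)[of b] by (simp add: ab scaleC_one)
    ultimately show ?case by simp
  qed simp
  then show ?thesis
    using length_eq biorthogonal assms by blast
qed

text \<open>
  Let \<open>m\<close> be the length of \<open>bs\<close>.  The scalar is the determinant of \<open>gb\<close>, but only its existence matters.  The image \<open>y\<close> of the volume
  element is killed by every \<open>b\<close>, as \<open>gb\<close> is onto, so \<open>killed_by_exterior\<close> applies; contracting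
  \<open>y\<close>, which has degree \<open>m\<close>, by \<open>m\<close> functionals leaves a multiple of \<open>1\<close>.
\<close>

lemma volume_eigenvector:
  fixes gv :: "'v::complex_vector \<Rightarrow> 'v"
  assumes "clinear gv" "clinear gb" "surj gb"
  shows "\<exists>c. ext_map (map_prod gv gb) volume = c *\<^sub>C volume"
proof -
  have g: "clinear (map_prod gv gb)"
    using assms by (simp add: clinear_iff map_prod_def prod_eq_iff case_prod_beta)
  let ?y = "ext_map (map_prod gv gb) volume"
  have "exterior (gb b) ?y = 0" for b
    using ext_map_lmul[OF g, of "(0, b)" volume] clinear_zero[OF assms(1)]
    by (simp add: exterior_volume clinear_zero[OF clinear_ext_map[OF g]])
  then have "exterior b ?y = 0" for b
    using assms(3) by (metis surjD)
  then have y: "?y = foldr exterior bs (fold interior as ?y)"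
    by (rule killed_by_exterior)
  have "fold interior as' y \<in> cvec.span (wedge ` {us. length us = 0})"
    if "y \<in> cvec.span (wedge ` {us. length us = length as'})" for as' and y :: "('v \<times> 'b) ext"
    using that by (induction as' arbitrary: y) (auto dest: contract_words[OF p_snd])
  moreover have "?y \<in> cvec.span (wedge ` {us. length us = length as})"
    by (auto simp: volume_def ext_map_wedge[OF g] length_eq intro!: cvec.span_base)
  ultimately have "fold interior as ?y \<in> cvec.span {wedge [] :: ('v \<times> 'b) ext}"
    by fastforce
  then obtain c where "fold interior as ?y = c *\<^sub>C wedge []"
    using cvec.span_singleton by auto
  moreover have "foldr exterior bs (c *\<^sub>C wedge []) = (c *\<^sub>C volume :: ('v \<times> 'b) ext)"
    using foldr_ext_lmul[of "map (Pair (0 :: 'v)) bs"]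
    by (simp add: volume_def foldr_map o_def clinear_scale[OF clinear_foldr[OF clinear_ext_lmul]])
  ultimately show ?thesis
    using y by metis
qed

text \<open>
  The operators \<open>mixed q\<close> are natural under maps that preserve the pairing, so both sides satisfy
  the same recursion in \<open>x\<close>; at \<open>x = 1\<close> they agree by the choice of \<open>c\<close>.
\<close>

lemma duality_equivariant:
  fixes gv :: "'v::complex_vector \<Rightarrow> 'v"
  assumes lin: "clinear gv" "clinear ga" "clinear gb"
    and invariant: "\<And>a b. p (ga a) (gb b) = p a b"
    and volume: "ext_map (map_prod gv gb) volume = c *\<^sub>C volume"
  shows "ext_map (map_prod gv gb) (duality x) = c *\<^sub>C duality (ext_map (map_prod gv ga) x)"
proof -
  have g: "clinear (map_prod gv gb)" "clinear (map_prod gv ga)"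
    using lin by (simp_all add: clinear_iff map_prod_def prod_eq_iff case_prod_beta)
  have "ext_map (map_prod gv gb) (mixed q y) =
      mixed (map_prod gv ga q) (ext_map (map_prod gv gb) y)" for q :: "'v \<times> 'a" and y
    using ext_map_contract[OF g(1) p_snd, of "ga (snd q)" y]
    by (simp add: mixed_def p_snd ext_map_lmul g clinear_simps[OF clinear_ext_map]
        clinear_zero[OF lin(3)] invariant)
  moreover have "mixed q (c *\<^sub>C y) = c *\<^sub>C mixed q y" for q :: "'v \<times> 'a" and y
    using square_zero_rep_mixed clinear_scale unfolding square_zero_rep_def by blast
  ultimately show ?thesis
    by (induction x rule: ext_induct)
      (simp_all add: clinear_simps[OF clinear_ext_map] g ext_map_wedge ext_map_lmul duality_simps
        duality_one duality_lmul volume scaleC_add_right scaleC_scaleC mult.commute)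
qed

text \<open>
  The composition commutes with left multiplication by \<open>(v, 0)\<close>, because both duality maps do,
  and with that by \<open>(0, a)\<close>, which \<open>duality\<close> turns into a contraction and the flipped map
  turns back.  At \<open>1\<close> its value is the
  iterated contraction of the flipped volume element, which is \<open>1\<close>.
\<close>

lemma duality_inverse:
  fixes x :: "('v::complex_vector \<times> 'a) ext"
  shows "dual_bases.duality (\<lambda>b a. p a b) (rev as) (duality x) = x"
proof -
  interpret flip: dual_bases "\<lambda>b a. p a b" "rev bs" "rev as"
    by (rule flipped)
  have exterior: "flip.duality (exterior b y) = flip.interior b (flip.duality y)" for b y
    by (simp add: flip.duality_lmul flip.mixed_def ext_lmul_zero_left flip: zero_prod_def)
  show ?thesis
  proof (induction x rule: ext_induct)
    case one
    have "flip.duality (wedge (map (Pair (0 :: 'v)) cs)) = foldr flip.interior cs flip.volume" for cs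
      by (induction cs) (simp_all add: flip.duality_one exterior flip: ext_lmul_wedge)
    then show ?case
      using flip.interior_volume by (simp add: duality_one volume_def foldr_conv_fold)
  next
    case (lmul q x)
    have "flip.duality (mixed q y) = ext_lmul q (flip.duality y)" for y
      using ext_lmul_add_left[of "(fst q, 0)" "(0, snd q)" "flip.duality y"]
        flip.duality_contract[of "snd q" y]
      by (simp add: mixed_def flip.duality_simps flip.duality_lmul flip.mixed_def flip.interior_zero_left)
    with lmul show ?case
      by (simp add: duality_lmul)
  qed (simp_all add: duality_simps flip.duality_simps)
qed

lemma bij_duality: "bij (duality :: ('v::complex_vector \<times> 'a) ext \<Rightarrow> _)"
proof -
  interpret flip: dual_bases "\<lambda>b a. p a b" "rev bs" "rev as"
    by (rule flipped)
  have "flip.duality \<circ> (duality :: ('v \<times> 'a) ext \<Rightarrow> _) = id"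
    by (simp add: fun_eq_iff duality_inverse)
  moreover have "(duality :: ('v \<times> 'a) ext \<Rightarrow> _) \<circ> flip.duality = id"
    using flip.duality_inverse by (auto simp: fun_eq_iff)
  ultimately show ?thesis
    by (rule o_bij)
qed

end

lemma dual_bases_exist:
  assumes "finite_dim TYPE('w::complex_vector)"
  shows "\<exists>as bs. dual_bases (dual_apply :: 'w dual \<Rightarrow> 'w \<Rightarrow> complex) as bs"
proof -
  obtain S :: "'w set" where S: "finite S" "cvec.span S = UNIV"
    using assms by (auto simp: finite_dim_def)
  obtain B where B: "B \<subseteq> S" "cvec.independent B" "cvec.span B = UNIV"
    using cvec.maximal_independent_subset[of S] S(2)
    by (metis cvec.span_mono cvec.span_span top.extremum_uniqueI)
  have "finite B"
    using B(1) S(1) finite_subset by blast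
  then obtain bs where bs: "set bs = B" "distinct bs"
    using finite_distinct_list by blast
  define e where "e b = Dual (\<lambda>w. cvec.representation B w b)" for b
  have rep: "clinear (\<lambda>w. cvec.representation B w b)" for b
    using B by (simp add: clinear_iff cvec.representation_add cvec.representation_scale scaleC_complex_def)
  have e: "dual_apply (e b) w = cvec.representation B w b" for b w
    by (simp add: e_def Dual_inverse rep)
  have app: "clinear (dual_apply a)" for a :: "'w dual"
    using dual_apply by auto
  have expand: "a = (\<Sum>b\<in>B. dual_apply a b *\<^sub>C e b)" for a
  proof -
    have sum: "dual_apply (\<Sum>b\<in>C. dual_apply a b *\<^sub>C e b) w = (\<Sum>b\<in>C. dual_apply a b * dual_apply (e b) w)"
      if "finite C" for C w
      using that by (induction C) (simp_all add: zero_dual.rep_eq plus_dual.rep_eq scaleC_dual.rep_eq)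
    have "dual_apply a w = dual_apply (\<Sum>b\<in>B. dual_apply a b *\<^sub>C e b) w" for w
    proof -
      have "w = (\<Sum>b\<in>B. cvec.representation B w b *\<^sub>C b)"
        using cvec.sum_representation_eq[of B w B] B \<open>finite B\<close> by simp
      moreover have "dual_apply a (\<Sum>b\<in>C. f b *\<^sub>C b) = (\<Sum>b\<in>C. dual_apply a b * f b)"
        if "finite C" for C f
        using that by (induction C) (simp_all add: clinear_simps[OF app] scaleC_complex_def)
      ultimately show ?thesis
        using \<open>finite B\<close> by (metis (no_types, lifting) sum e sum.cong)
    qed
    then show ?thesis
      by (intro iffD1[OF dual_apply_inject] ext)
  qed
  have "dual_bases dual_apply (map e bs) bs"
  proof (rule dual_bases.intro)
    show "clinear (\<lambda>a. dual_apply a b)" for b :: 'w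
      by (simp add: clinear_iff plus_dual.rep_eq scaleC_dual.rep_eq scaleC_complex_def)
    show "dual_apply (map e bs ! i) (bs ! j) = (if i = j then 1 else 0)"
      if "i < length bs" "j < length bs" for i j
    proof -
      have "bs ! i \<in> B" "bs ! j \<in> B"
        using that bs(1) by auto
      then show ?thesis
        using that bs(2) B(2) by (auto simp: e cvec.representation_basis nth_eq_iff_index_eq)
    qed
    have "a \<in> cvec.span (set (map e bs))" for a
      by (subst expand) (intro cvec.span_sum cvec.span_scale cvec.span_base, simp add: bs)
    then show "cvec.span (set (map e bs)) = UNIV"
      by blast
  qed (use app B bs in auto)
  then show ?thesis by blast
qed

section \<open>Multiplicity-freeness of twisted modules\<close>

text \<open>
  The scalars \<open>c\<close> do not matter because submodules are closed under scaling and module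
  isomorphisms are linear: transport along \<open>h\<close> multiplies the actions on source and target of an
  isomorphism by the same nonzero \<open>c\<close>.
\<close>

lemma multiplicity_free_twist_imp:
  fixes h :: "'x::complex_vector \<Rightarrow> 'y::complex_vector"
  assumes h: "clinear h" "bij h"
    and twist: "\<And>g. g \<in> G \<Longrightarrow> \<exists>c. c \<noteq> 0 \<and> (\<forall>x. h (\<rho> g x) = c *\<^sub>C \<sigma> g (h x))"
    and mf: "multiplicity_free G \<rho>"
  shows "multiplicity_free G \<sigma>"
proof -
  obtain S where mf_S: "is_direct_sum S (\<lambda>W. W) \<and> (\<forall>W\<in>S. irreducible_submodule G \<rho> W) \<and>
      (\<forall>W\<in>S. \<forall>W'\<in>S. W \<noteq> W' \<longrightarrow> \<not> isomorphic_submodules G \<rho> W W')"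
    using mf unfolding multiplicity_free_def by (rule exE)
  then have S: "is_direct_sum S (\<lambda>W. W)" "W \<in> S \<Longrightarrow> irreducible_submodule G \<rho> W"
    and distinct: "\<lbrakk>W \<in> S; W' \<in> S; isomorphic_submodules G \<rho> W W'\<rbrakk> \<Longrightarrow> W = W'" for W W'
    by simp_all metis
  note lin = clinear_simps[OF h(1)]
  interpret Vector_Spaces.linear scaleC scaleC h
    by (rule h(1))
  have inj: "inj h" and surj: "surj h"
    using h(2) by (auto simp: bij_def)
  have sub_image: "submodule G \<sigma> (h ` W)" if W: "submodule G \<rho> W" for W
    unfolding submodule_def
  proof (intro conjI ballI)
    show sub: "cvec.subspace (h ` W)"
      using W h by (simp add: submodule_def subspace_image)
    fix g y
    assume g: "g \<in> G" and "y \<in> h ` W"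
    then obtain w where w: "w \<in> W" "y = h w" by blast
    obtain c where c: "c \<noteq> 0" "\<And>x. h (\<rho> g x) = c *\<^sub>C \<sigma> g (h x)"
      using twist[OF g] by blast
    have "\<sigma> g y = inverse c *\<^sub>C h (\<rho> g w)"
      using c by (simp add: w scaleC_scaleC scaleC_one)
    moreover have "h (\<rho> g w) \<in> h ` W"
      using W g w by (simp add: submodule_def)
    ultimately show "\<sigma> g y \<in> h ` W"
      using sub by (simp add: cvec.subspace_scale)
  qed
  have sub_vimage: "submodule G \<rho> (h -` W)" if W: "submodule G \<sigma> W" for W
    unfolding submodule_def
  proof (intro conjI ballI)
    show "cvec.subspace (h -` W)"
      using W h by (simp add: submodule_def subspace_vimage)
    fix g x
    assume g: "g \<in> G" and x: "x \<in> h -` W"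
    obtain c where "\<And>x. h (\<rho> g x) = c *\<^sub>C \<sigma> g (h x)"
      using twist[OF g] by blast
    then show "\<rho> g x \<in> h -` W"
      using W g x by (simp add: submodule_def cvec.subspace_scale)
  qed
  have irr: "irreducible_submodule G \<sigma> (h ` W)" if W: "irreducible_submodule G \<rho> W" for W
    unfolding irreducible_submodule_def
  proof (intro conjI allI impI)
    show "submodule G \<sigma> (h ` W)"
      using W by (simp add: irreducible_submodule_def sub_image)
    have "W \<noteq> {0}"
      using W by (simp add: irreducible_submodule_def)
    then show "h ` W \<noteq> {0}"
      using inj by (metis image_empty image_insert inj_image_eq_iff lin(3))
    fix W'
    assume W': "submodule G \<sigma> W' \<and> W' \<subseteq> h ` W"
    have "h -` W' \<subseteq> W"
      using W' inj by (auto dest: injD)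
    then have "h -` W' = {0} \<or> h -` W' = W"
      using W W' by (simp add: irreducible_submodule_def sub_vimage)
    then show "W' = {0} \<or> W' = h ` W"
      using surj by (metis image_empty image_insert lin(3) surj_image_vimage_eq)
  qed
  have iso: "isomorphic_submodules G \<rho> W W'"
    if W: "submodule G \<rho> W" and iso: "isomorphic_submodules G \<sigma> (h ` W) (h ` W')" for W W'
  proof -
    obtain \<phi> where \<phi>: "bij_betw \<phi> (h ` W) (h ` W') \<and>
        (\<forall>x\<in>h ` W. \<forall>y\<in>h ` W. \<phi> (x + y) = \<phi> x + \<phi> y) \<and>
        (\<forall>c. \<forall>x\<in>h ` W. \<phi> (c *\<^sub>C x) = c *\<^sub>C \<phi> x) \<and>
        (\<forall>g\<in>G. \<forall>x\<in>h ` W. \<phi> (\<sigma> g x) = \<sigma> g (\<phi> x))"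
      using iso unfolding isomorphic_submodules_def by (rule exE)
    then have bij: "bij_betw \<phi> (h ` W) (h ` W')"
      by (rule conjunct1)
    from \<phi> have add: "\<phi> (x + y) = \<phi> x + \<phi> y" if "x \<in> h ` W" "y \<in> h ` W" for x y
      using that by metis
    from \<phi> have scale: "\<phi> (c *\<^sub>C x) = c *\<^sub>C \<phi> x" if "x \<in> h ` W" for c x
      using that by metis
    from \<phi> have equi: "\<phi> (\<sigma> g x) = \<sigma> g (\<phi> x)" if "g \<in> G" "x \<in> h ` W" for g x
      using that by metis
    define \<psi> where "\<psi> x = inv_into UNIV h (\<phi> (h x))" for x
    have \<psi>: "h (\<psi> x) = \<phi> (h x)" for x
      by (simp add: \<psi>_def surj surj_f_inv_f)
    have "bij_betw h W (h ` W)"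
      using inj by (auto simp: bij_betw_def intro: inj_on_subset)
    moreover have "bij_betw (inv_into UNIV h) (h ` W') W'"
      using inj by (simp add: bij_betw_def inj_on_def image_image)
    ultimately have "bij_betw (inv_into UNIV h \<circ> (\<phi> \<circ> h)) W W'"
      using bij by (blast intro: bij_betw_trans)
    then have "bij_betw \<psi> W W'"
      by (simp add: o_def \<psi>_def[abs_def])
    moreover have "\<psi> (x + y) = \<psi> x + \<psi> y" if "x \<in> W" "y \<in> W" for x y
      using that by (intro injD[OF inj]) (simp add: \<psi> lin add)
    moreover have "\<psi> (c *\<^sub>C x) = c *\<^sub>C \<psi> x" if "x \<in> W" for c x
      using that by (intro injD[OF inj]) (simp add: \<psi> lin scale)
    moreover have "\<psi> (\<rho> g x) = \<rho> g (\<psi> x)" if g: "g \<in> G" and x: "x \<in> W" for g x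
    proof (rule injD[OF inj])
      obtain c where c: "\<And>x. h (\<rho> g x) = c *\<^sub>C \<sigma> g (h x)"
        using twist[OF g] by blast
      have "\<sigma> g (h x) \<in> h ` W"
        using sub_image[OF W] g x by (simp add: submodule_def)
      then show "h (\<psi> (\<rho> g x)) = h (\<rho> g (\<psi> x))"
        using g x by (simp add: \<psi> c scale equi)
    qed
    ultimately show ?thesis
      unfolding isomorphic_submodules_def by (intro exI[of _ \<psi>]) simp
  qed
  have inj_image: "inj_on ((`) h) S"
    using inj by (intro inj_onI) (simp add: inj_image_eq_iff)
  have dsum: "is_direct_sum ((`) h ` S) (\<lambda>W. W)"
    unfolding is_direct_sum_def
  proof (intro conjI allI ballI)
    show "finite ((`) h ` S)"
      using S(1) by (simp add: is_direct_sum_def)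
    show "cvec.subspace W" if "W \<in> (`) h ` S" for W
      using that S(1) h by (auto simp: is_direct_sum_def subspace_image)
    fix y
    let ?dec = "\<lambda>f. f \<in> (\<Pi>\<^sub>E W\<in>S. W) \<and> inv_into UNIV h y = (\<Sum>W\<in>S. f W)"
    have h_sum: "h (\<Sum>W\<in>C. f W) = (\<Sum>W\<in>C. h (f W))" for C and f :: "'x set \<Rightarrow> 'x"
      by (induction C rule: infinite_finite_induct) (simp_all add: lin)
    obtain f where f: "?dec f" and uniq: "\<And>f'. ?dec f' \<Longrightarrow> f' = f"
      using S(1) unfolding is_direct_sum_def by metis
    show "\<exists>!f. f \<in> (\<Pi>\<^sub>E W\<in>(`) h ` S. W) \<and> y = (\<Sum>W\<in>(`) h ` S. f W)"
    proof (rule ex1I)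
      let ?f = "restrict (\<lambda>W. h (f (h -` W))) ((`) h ` S)"
      have "(\<Sum>W\<in>(`) h ` S. ?f W) = (\<Sum>W\<in>S. h (f W))"
        using inj by (simp add: sum.reindex[OF inj_image] inj_vimage_image_eq)
      also have "\<dots> = y"
        using f surj_f_inv_f[OF surj, of y] by (simp flip: h_sum)
      finally show "?f \<in> (\<Pi>\<^sub>E W\<in>(`) h ` S. W) \<and> y = (\<Sum>W\<in>(`) h ` S. ?f W)"
        using f inj by (auto simp: inj_vimage_image_eq)
      fix k
      assume k: "k \<in> (\<Pi>\<^sub>E W\<in>(`) h ` S. W) \<and> y = (\<Sum>W\<in>(`) h ` S. k W)"
      let ?k = "restrict (\<lambda>W. inv_into UNIV h (k (h ` W))) S"
      have "?dec ?k"
      proof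
        show "?k \<in> (\<Pi>\<^sub>E W\<in>S. W)"
        proof (rule PiE_I)
          fix W
          assume W: "W \<in> S"
          then have "k (h ` W) \<in> h ` W"
            using k by blast
          then show "?k W \<in> W"
            using W inj by auto
        qed simp
        have "h (\<Sum>W\<in>S. ?k W) = y"
          unfolding h_sum using k by (simp add: surj_f_inv_f[OF surj] sum.reindex[OF inj_image])
        then show "inv_into UNIV h y = (\<Sum>W\<in>S. ?k W)"
          using inj by (metis inv_f_f)
      qed
      then have f: "?k = f"
        by (rule uniq)
      have "h (f W) = k (h ` W)" if "W \<in> S" for W
        using that surj unfolding f[symmetric] by (simp add: surj_f_inv_f)
      then show "k = ?f"
        using k inj
        by (intro extensionalityI[of _ "(`) h ` S"]) (auto simp: inj_vimage_image_eq PiE_def)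
    qed
  qed
  have "irreducible_submodule G \<sigma> W" if "W \<in> (`) h ` S" for W
    using that S(2) irr by auto
  moreover have "\<not> isomorphic_submodules G \<sigma> W W'"
    if W: "W \<in> (`) h ` S" "W' \<in> (`) h ` S" "W \<noteq> W'" for W W'
  proof
    obtain A B where AB: "A \<in> S" "W = h ` A" "B \<in> S" "W' = h ` B"
      using W(1,2) by auto
    assume "isomorphic_submodules G \<sigma> W W'"
    then have "isomorphic_submodules G \<rho> A B"
      using S(2)[OF AB(1)] unfolding AB(2,4) by (intro iso) (simp_all add: irreducible_submodule_def)
    then show False
      using distinct AB \<open>W \<noteq> W'\<close> by auto
  qed
  ultimately show ?thesis
    using dsum unfolding multiplicity_free_def by (intro exI[of _ "(`) h ` S"]) simp
qed

lemma multiplicity_free_twist: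
  fixes h :: "'x::complex_vector \<Rightarrow> 'y::complex_vector"
  assumes h: "clinear h" "bij h"
    and twist: "\<And>g. g \<in> G \<Longrightarrow> \<exists>c. c \<noteq> 0 \<and> (\<forall>x. h (\<rho> g x) = c *\<^sub>C \<sigma> g (h x))"
  shows "multiplicity_free G \<rho> \<longleftrightarrow> multiplicity_free G \<sigma>"
proof
  show "multiplicity_free G \<rho> \<Longrightarrow> multiplicity_free G \<sigma>"
    using multiplicity_free_twist_imp[of h G \<rho> \<sigma>] assms by blast
  have inv: "inv_into UNIV h (h x) = x" "h (inv_into UNIV h y) = y" for x y
    using h(2) by (simp_all add: bij_is_inj bij_is_surj surj_f_inv_f)
  have "clinear (inv_into UNIV h)"
    unfolding clinear_iff by (metis clinear_add[OF h(1)] clinear_scale[OF h(1)] inv)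
  moreover have "bij (inv_into UNIV h)"
    using h(2) by (rule bij_imp_bij_inv)
  moreover have "\<exists>c. c \<noteq> 0 \<and> (\<forall>y. inv_into UNIV h (\<sigma> g y) = c *\<^sub>C \<rho> g (inv_into UNIV h y))" if g: "g \<in> G" for g
  proof -
    obtain c where c: "c \<noteq> 0" "\<And>x. h (\<rho> g x) = c *\<^sub>C \<sigma> g (h x)"
      using twist[OF g] by blast
    have "inv_into UNIV h (\<sigma> g y) = inverse c *\<^sub>C \<rho> g (inv_into UNIV h y)" for y
    proof -
      have "h (inverse c *\<^sub>C \<rho> g (inv_into UNIV h y)) = \<sigma> g y"
        using c by (simp add: clinear_scale[OF h(1)] inv scaleC_scaleC scaleC_one)
      then show ?thesis
        by (metis inv(1))
    qed
    then show ?thesis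
      using c(1) by (metis nonzero_imp_inverse_nonzero)
  qed
  ultimately show "multiplicity_free G \<sigma> \<Longrightarrow> multiplicity_free G \<rho>"
    using multiplicity_free_twist_imp[of "inv_into UNIV h" G \<sigma> \<rho>] by blast
qed

section \<open>Dualizing a summand\<close>

lemma group_GL: "group (GL n)"
proof (rule groupI)
  fix A
  assume "A \<in> carrier (GL n)"
  then have "A \<in> Units (ring_mat TYPE(complex) n ())" and A: "A \<in> carrier_mat n n" "det A \<noteq> 0"
    by (simp_all add: GL_def det_non_zero_imp_unit)
  then obtain B where B: "B \<in> carrier_mat n n" "B * A = 1\<^sub>m n"
    by (auto simp: Units_def ring_mat_simps)
  then have "det B * det A = 1"
    using A det_mult[of B n A] by simp
  then show "\<exists>B\<in>carrier (GL n). B \<otimes>\<^bsub>GL n\<^esub> A = \<one>\<^bsub>GL n\<^esub>"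
    using B by (auto simp: GL_def)
qed (auto simp: GL_def det_mult[of _ n])

theorem lemma5p2:
  fixes n :: nat
    and G :: "complex mat set"
    and \<rho>\<^sub>1 :: "complex mat \<Rightarrow> 'v::complex_vector \<Rightarrow> 'v"
    and \<rho>\<^sub>2 :: "complex mat \<Rightarrow> 'w::complex_vector \<Rightarrow> 'w"
  assumes "reductive n G"
    and "rational_module n G \<rho>\<^sub>1"
    and "rational_module n G \<rho>\<^sub>2"
    and "saturated n G (direct_sum_act \<rho>\<^sub>1 \<rho>\<^sub>2)"
  shows "skew_multiplicity_free G (direct_sum_act \<rho>\<^sub>1 \<rho>\<^sub>2) \<longleftrightarrow>
         skew_multiplicity_free G (direct_sum_act \<rho>\<^sub>1 (dual_act n \<rho>\<^sub>2))"
proof -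
  have "subgroup G (GL n)"
    using assms(1) by (simp add: reductive_def alg_group_def)
  then interpret subgroup G "GL n" .
  obtain as bs where "dual_bases (dual_apply :: 'w dual \<Rightarrow> 'w \<Rightarrow> complex) as bs"
    using dual_bases_exist assms(3) by (auto simp: rational_module_def)
  then interpret dual_bases "dual_apply :: 'w dual \<Rightarrow> 'w \<Rightarrow> complex" as bs .
  let ?D = "duality :: ('v \<times> 'w dual) ext \<Rightarrow> ('v \<times> 'w) ext"
  have "\<exists>c. c \<noteq> 0 \<and> (\<forall>x. ?D (ext_act (direct_sum_act \<rho>\<^sub>1 (dual_act n \<rho>\<^sub>2)) g x) =
      c *\<^sub>C ext_act (direct_sum_act \<rho>\<^sub>1 \<rho>\<^sub>2) g (?D x))" if g: "g \<in> G" for g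
  proof -
    let ?g' = "inv\<^bsub>GL n\<^esub> g"
    let ?E = "\<lambda>g. ext_map (map_prod (\<rho>\<^sub>1 g) (\<rho>\<^sub>2 g))"
    have g': "?g' \<in> G"
      using g by (rule m_inv_closed)
    have "g \<in> carrier (GL n)"
      using g subset by blast
    then have "?g' * g = 1\<^sub>m n" "g * ?g' = 1\<^sub>m n"
      using group.l_inv[OF group_GL] group.r_inv[OF group_GL] by (auto simp: GL_def)
    then have inv1: "\<rho>\<^sub>1 ?g' (\<rho>\<^sub>1 g v) = v" and inv2: "\<rho>\<^sub>2 ?g' (\<rho>\<^sub>2 g w) = w"
      and inv3: "\<rho>\<^sub>2 g (\<rho>\<^sub>2 ?g' w) = w" for v w
      using assms(2,3) g g' unfolding rational_module_def by metis+
    have lin: "clinear (\<rho>\<^sub>1 g)" "clinear (\<rho>\<^sub>2 g)" "clinear (\<rho>\<^sub>1 ?g')" "clinear (\<rho>\<^sub>2 ?g')"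
      using assms(2,3) g g' by (auto simp: rational_module_def)
    have dual: "dual_apply (dual_act n \<rho>\<^sub>2 g f) w = dual_apply f (\<rho>\<^sub>2 ?g' w)" for f w
    proof -
      have "clinear (\<lambda>v. dual_apply f (\<rho>\<^sub>2 ?g' v))"
        using p_right[of f] lin(4) by (simp add: clinear_iff)
      then show ?thesis
        by (simp add: dual_act_def Dual_inverse)
    qed
    have lin_dual: "clinear (dual_act n \<rho>\<^sub>2 g)"
      unfolding clinear_iff
      by (simp add: dual_apply_inject[symmetric] fun_eq_iff dual plus_dual.rep_eq scaleC_dual.rep_eq)
    have "surj (\<rho>\<^sub>2 g)"
      using inv3 by (metis surjI)
    then obtain c0 where c0: "?E g volume = c0 *\<^sub>C volume"
      using volume_eigenvector[of "\<rho>\<^sub>1 g" "\<rho>\<^sub>2 g"] lin by blast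
    \<comment> \<open>If \<open>c0 = 0\<close>, applying the inverse of \<open>g\<close> shows that \<open>volume = 0\<close>, and any scalar will do.\<close>
    have "\<exists>c. c \<noteq> 0 \<and> ?E g volume = c *\<^sub>C volume"
    proof (cases "c0 = 0")
      case True
      have pairs: "clinear (map_prod (\<rho>\<^sub>1 g) (\<rho>\<^sub>2 g))" "clinear (map_prod (\<rho>\<^sub>1 ?g') (\<rho>\<^sub>2 ?g'))"
        using lin by (simp_all add: clinear_iff map_prod_def prod_eq_iff case_prod_beta)
      have "?E ?g' (?E g volume) = volume"
        by (simp add: volume_def ext_map_wedge pairs inv2 inv1 o_def case_prod_beta)
      then have "volume = (0 :: ('v \<times> 'w) ext)"
        using c0 True by (simp add: clinear_zero[OF clinear_ext_map[OF pairs(2)]])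
      then have "?E g volume = 1 *\<^sub>C volume"
        using c0 by simp
      then show ?thesis
        by (metis one_neq_zero)
    qed (use c0 in blast)
    then obtain c where c: "c \<noteq> 0" "?E g volume = c *\<^sub>C volume"
      by blast
    have "?E g (?D x) = c *\<^sub>C ?D (ext_map (map_prod (\<rho>\<^sub>1 g) (dual_act n \<rho>\<^sub>2 g)) x)" for x
      by (rule duality_equivariant) (simp_all add: lin lin_dual dual inv2 c)
    then have "?D (ext_map (map_prod (\<rho>\<^sub>1 g) (dual_act n \<rho>\<^sub>2 g)) x) = inverse c *\<^sub>C ?E g (?D x)" for x
      using c(1) by (simp add: scaleC_scaleC scaleC_one)
    then show ?thesis
      using c(1) unfolding ext_act_def direct_sum_act_def
      by (metis nonzero_imp_inverse_nonzero)
  qed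
  then have "multiplicity_free G (ext_act (direct_sum_act \<rho>\<^sub>1 (dual_act n \<rho>\<^sub>2))) \<longleftrightarrow>
      multiplicity_free G (ext_act (direct_sum_act \<rho>\<^sub>1 \<rho>\<^sub>2))"
    by (rule multiplicity_free_twist[OF clinear_duality bij_duality])
  then show ?thesis
    by (simp add: skew_multiplicity_free_def)
qed

end
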